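(* Let $\mathcal{K}=(S,AP,\mathcal{L},\to)$ be a weighted Kripke structure and $\mathcal{K}_{\mathcal{P}}=(S_{\mathcal{P}},AP,\mathcal{L}_{\mathcal{P}},\to^{\mathcal{P}})$ a strongly cost non-zeno parametric weighted Kripke structure. There exists a natural number $n$ such that for all states $s\in S$, $t\in S_{\mathcal{P}}$ and all valuations $v\in\mathcal{V}$, \[ \llbracket \mathcal{F}_{\mathcal{E}}^n(d_{\mathcal{E}}^0)(s,t)\rrbracket(v)=d_{\min}(s,t)(v). \]
   Context: A weighted Kripke structure (WKS) is $\mathcal{K}=(S,AP,\mathcal{L},\to)$ with $S$ a finite set of states, $AP$ a set of atomic propositions, $\mathcal{L}:S\to\mathcal{P}(AP)$, and $\to\subseteq S\times\mathbb{Q}_{\ge0}\times S$ finite; write $s\to_w s'$. Fix a finite set of parameters $\mathcal{P}=\{p_1,\ldots,p_k\}$. A parametric WKS (PWKS) $\mathcal{K}_{\mathcal{P}}=(S_{\mathcal{P}},AP,\mathcal{L}_{\mathcal{P}},\to^{\mathcal{P}})$ is like a WKS except that $\to^{\mathcal{P}}\subseteq S_{\mathcal{P}}\times(\mathcal{P}\cup\mathbb{Q}_{\ge0})\times S_{\mathcal{P}}$ (finite). A valuation is $v:\mathcal{P}\to\mathbb{Q}_{\ge0}$; $\mathcal{V}$ is the set of valuations. The accumulated weight of a PWKS transition sequence $t=t_0\to^{\mathcal{P}}_{v_1}t_1\cdots\to^{\mathcal{P}}_{v_n}t_n$ is the linear expression $\sum_iv_i=\sum_ja_jp_j+b$ ($a_j\in\mathbb{N}$,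 $b\in\mathbb{Q}_{\ge0}$; $0$ for $n=0$). The PWKS is strongly cost non-zeno if there is $w_{\min}>0$ such that for every valuation every loop (nonempty transition sequence returning to its first state) has accumulated weight at least $w_{\min}$. Semantic distance: $\mathcal{D}$ is the set of functions $d:S\times S_{\mathcal{P}}\to(\mathcal{V}\to[0,\infty])$ ordered pointwise (a complete lattice). $\mathcal{F}:\mathcal{D}\to\mathcal{D}$: $\mathcal{F}(d)(s,t)(v)=\infty$ if $\mathcal{L}(s)\neq\mathcal{L}_{\mathcal{P}}(t)$, otherwise \[ \max_{s\to_w s'}\ \min_{t\to^{\mathcal{P}}_{v_1}t_1\cdots\to^{\mathcal{P}}_{v_n}t_n}\max\Big\{\Big|\tfrac{\llbracket\sum_{i=1}^n v_i\rrbracket(v)}{w}-1\Big|,\ d(s',t_n)(v),\ \max\{d(s,t_i)(v)\mid1\le i<n\}\Big\} \] (max over transitions of $s$ in $\mathcal{K}$; min, understood as infimum, over PWKS sequences from $t$; max of empty set $0$). $\mathcal{F}$ is monotone and $d_{\min}$ denotes its least fixed point. Syntactic distance: expressions $E::=\infty\mid\big|\frac{e}{w}-1\big|\mid\texttt{MIN}\{E_1,\ldots\}\mid\texttt{MAX}\{E_1,\ldots\}$ with $w\in\mathbb{Q}_{\ge0}$, $e=\sum_ja_jp_j+b$; $\llbracket E\rrbracket(v)$ is its value under $v$ ($\texttt{MIN},\texttt{MAX}$ read as min, max). Expressions are kept in normal form (a $\texttt{MIN}$ of $\texttt{MAX}$'s of basic elements) using distributivity $\texttt{MAX}\{\texttt{MIN}\{E_1,E_2\},E_3\}\mapsto\texttt{MIN}\{\texttt{MAX}\{E_1,E_3\},\texttt{MAX}\{E_2,E_3\}\}$.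 The operator $\mathcal{F}_{\mathcal{E}}$ on functions $d_{\mathcal{E}}$ from $S\times S_{\mathcal{P}}$ to normal-form expressions: $\mathcal{F}_{\mathcal{E}}(d_{\mathcal{E}})(s,t)=\infty$ if $\mathcal{L}(s)\neq\mathcal{L}_{\mathcal{P}}(t)$, otherwise the normal form of \[ \texttt{MAX}_{s\to_w s'}\Big\{\texttt{MIN}_{t\to^{\mathcal{P}}_{v_1}t_1\cdots\to^{\mathcal{P}}_{v_n}t_n}\Big\{\texttt{MAX}\Big\{\Big|\tfrac{\sum_{i=1}^n v_i}{w}-1\Big|,\ d_{\mathcal{E}}(s',t_n),\ \texttt{MAX}\{d_{\mathcal{E}}(s,t_i)\mid i<n\}\Big\}\Big\}\Big\}. \] $d_{\mathcal{E}}^0$ is the initial syntactic distance function assigning to every pair an expression with value $0$ under every valuation. *)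

theory Defs
  imports
    Complex_Main
    "HOL-Library.Extended_Nonnegative_Real"
    "HOL-Library.Countable_Set_Type"
    "HOL-Library.FSet"
begin

typedef nnrat = "{q :: rat. 0 \<le> q}"
  morphisms rat_of_nnrat Abs_nnrat
  by auto

setup_lifting type_definition_nnrat

instantiation nnrat :: comm_monoid_add
begin

lift_definition zero_nnrat :: nnrat is 0 by simp
lift_definition plus_nnrat :: "nnrat \<Rightarrow> nnrat \<Rightarrow> nnrat" is "(+)" by simp

instance by standard (transfer; simp add: algebra_simps)+

end

definition real_of_nnrat :: "nnrat \<Rightarrow> real" where
  "real_of_nnrat q = real_of_rat (rat_of_nnrat q)"

type_synonym 'p valuation = "'p \<Rightarrow> nnrat"


text \<open>The finite state spaces and the finite parameter set are rendered as finite types.\<close>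

record ('s, 'ap) wks =
  label :: "'s \<Rightarrow> 'ap set"
  transitions :: "('s \<times> nnrat \<times> 's) set"

datatype 'p weight = Param 'p | Const nnrat

record ('t, 'p, 'ap) pwks =
  plabel :: "'t \<Rightarrow> 'ap set"
  ptransitions :: "('t \<times> 'p weight \<times> 't) set"

definition is_wks :: "('s::finite, 'ap) wks \<Rightarrow> bool" where
  "is_wks K \<longleftrightarrow> finite (transitions K)"

definition is_pwks :: "('t::finite, 'p::finite, 'ap) pwks \<Rightarrow> bool" where
  "is_pwks KP \<longleftrightarrow> finite (ptransitions KP)"


text \<open>\<open>Lin a b\<close> is the linear expression \<open>(\<Sum>p. a p * p) + b\<close>.\<close>

datatype 'p linexp = Lin "'p \<Rightarrow> nat" nnrat

primrec lin_value :: "'p::finite linexp \<Rightarrow> 'p valuation \<Rightarrow> real" where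
  "lin_value (Lin a b) v = (\<Sum>p\<in>UNIV. real (a p) * real_of_nnrat (v p)) + real_of_nnrat b"

definition lin_zero :: "'p linexp" where
  "lin_zero = Lin (\<lambda>_. 0) 0"

fun lin_add :: "'p linexp \<Rightarrow> 'p linexp \<Rightarrow> 'p linexp" where
  "lin_add (Lin a b) (Lin a' b') = Lin (\<lambda>p. a p + a' p) (b + b')"

primrec lin_of_weight :: "'p weight \<Rightarrow> 'p linexp" where
  "lin_of_weight (Param p) = Lin (\<lambda>q. if q = p then 1 else 0) 0"
| "lin_of_weight (Const c) = Lin (\<lambda>_. 0) c"


text \<open>
  A transition sequence \<open>t \<rightarrow> t\<^sub>1 \<dots> \<rightarrow> t\<^sub>n\<close> with weights \<open>v\<^sub>1, \<dots>, v\<^sub>n\<close> is represented by its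
  start \<open>t\<close> and the list \<open>[(v\<^sub>1, t\<^sub>1), \<dots>, (v\<^sub>n, t\<^sub>n)]\<close>; the empty list is the sequence with \<open>n = 0\<close>.
\<close>

type_synonym ('t, 'p) steps = "('p weight \<times> 't) list"

fun is_seq :: "('t, 'p, 'ap) pwks \<Rightarrow> 't \<Rightarrow> ('t, 'p) steps \<Rightarrow> bool" where
  "is_seq KP t [] \<longleftrightarrow> True"
| "is_seq KP t ((x, u) # \<pi>) \<longleftrightarrow> (t, x, u) \<in> ptransitions KP \<and> is_seq KP u \<pi>"

definition seqs :: "('t, 'p, 'ap) pwks \<Rightarrow> 't \<Rightarrow> ('t, 'p) steps set" where
  "seqs KP t = {\<pi>. is_seq KP t \<pi>}"

definition last_state :: "'t \<Rightarrow> ('t, 'p) steps \<Rightarrow> 't" where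
  "last_state t \<pi> = last (t # map snd \<pi>)"

text \<open>The states \<open>t\<^sub>i\<close> with \<open>1 \<le> i < n\<close>.\<close>

definition inner_states :: "('t, 'p) steps \<Rightarrow> 't list" where
  "inner_states \<pi> = butlast (map snd \<pi>)"

definition acc_weight :: "('t, 'p) steps \<Rightarrow> 'p linexp" where
  "acc_weight \<pi> = foldr lin_add (map (lin_of_weight \<circ> fst) \<pi>) lin_zero"

definition is_loop :: "('t, 'p, 'ap) pwks \<Rightarrow> 't \<Rightarrow> ('t, 'p) steps \<Rightarrow> bool" where
  "is_loop KP t \<pi> \<longleftrightarrow> \<pi> \<noteq> [] \<and> is_seq KP t \<pi> \<and> last_state t \<pi> = t"

definition strongly_cost_non_zeno :: "('t, 'p::finite, 'ap) pwks \<Rightarrow> bool" where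
  "strongly_cost_non_zeno KP \<longleftrightarrow>
    (\<exists>wmin::real. wmin > 0 \<and>
      (\<forall>v t \<pi>. is_loop KP t \<pi> \<longrightarrow> lin_value (acc_weight \<pi>) v \<ge> wmin))"


text \<open>
  The quantity \<open>\<bar>x / w - 1\<bar>\<close> in \<open>[0, \<infinity>]\<close>. For \<open>w = 0\<close> we use the conventions \<open>0 / 0 = 1\<close> (an
  exact match has deviation \<open>0\<close>) and \<open>x / 0 = \<infinity>\<close> for \<open>x > 0\<close>, not HOL's \<open>x / 0 = 0\<close>.
\<close>

definition deviation :: "real \<Rightarrow> nnrat \<Rightarrow> ennreal" where
  "deviation x w =
    (if w = 0 then (if x = 0 then 0 else \<infinity>)
     else ennreal \<bar>x / real_of_nnrat w - 1\<bar>)"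


text \<open>
  In the lattice \<open>[0, \<infinity>]\<close> the empty supremum is \<open>0\<close>, and the suprema below are over finite sets.
\<close>

type_synonym ('s, 't, 'p) distance = "'s \<Rightarrow> 't \<Rightarrow> 'p valuation \<Rightarrow> ennreal"

definition sem_op ::
  "('s::finite, 'ap) wks \<Rightarrow> ('t::finite, 'p::finite, 'ap) pwks \<Rightarrow>
    ('s, 't, 'p) distance \<Rightarrow> ('s, 't, 'p) distance" where
  "sem_op K KP d s t v =
    (if label K s \<noteq> plabel KP t then \<infinity>
     else (SUP (w, s') \<in> {(w, s'). (s, w, s') \<in> transitions K}.
            INF \<pi> \<in> seqs KP t.
              Sup {deviation (lin_value (acc_weight \<pi>) v) w,
                   d s' (last_state t \<pi>) v,
                   (SUP u \<in> set (inner_states \<pi>). d s u v)}))"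

lemma mono_sem_op: "mono (sem_op K KP)"
proof (rule monoI, intro le_funI)
  fix d d' :: "('a, 'b, 'c) distance" and s t v
  assume "d \<le> d'"
  then have le: "d x y z \<le> d' x y z" for x y z
    by (simp add: le_fun_def)
  then show "sem_op K KP d s t v \<le> sem_op K KP d' s t v"
    unfolding sem_op_def
    by (auto intro!: SUP_mono' INF_mono' sup_mono)
qed

definition d_min ::
  "('s::finite, 'ap) wks \<Rightarrow> ('t::finite, 'p::finite, 'ap) pwks \<Rightarrow> ('s, 't, 'p) distance" where
  "d_min K KP = lfp (sem_op K KP)"


text \<open>
  \<open>EMin\<close> ranges over countable sets because a state may have infinitely many outgoing transition
  sequences; \<open>EMax\<close> only ever ranges over finite sets.
\<close>

datatype 'p expr =
    Infty
  | Dev "'p linexp" nnrat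
  | EMin "'p expr cset"
  | EMax "'p expr fset"

primrec expr_value :: "'p::finite expr \<Rightarrow> 'p valuation \<Rightarrow> ennreal" where
  "expr_value Infty v = \<infinity>"
| "expr_value (Dev e w) v = deviation (lin_value e v) w"
| "expr_value (EMin C) v = Inf (rcset (cimage (\<lambda>E. expr_value E v) C))"
| "expr_value (EMax F) v = Sup (fset ((\<lambda>E. expr_value E v) |`| F))"

definition basic :: "'p expr \<Rightarrow> bool" where
  "basic E \<longleftrightarrow> E = Infty \<or> (\<exists>e w. E = Dev e w)"

definition normal_form :: "'p expr \<Rightarrow> bool" where
  "normal_form E \<longleftrightarrow>
    (\<exists>C. E = EMin (cimage EMax C) \<and> (\<forall>F \<in> rcset C. \<forall>B \<in> fset F. basic B))"

text \<open>
  A clause is a finite set of basic expressions, read as their \<open>MAX\<close>. Distributing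
  \<open>MAX {E\<^sub>1, \<dots>, E\<^sub>k}\<close> over \<open>MIN\<close> yields one clause for every way of choosing a clause of each
  \<open>E\<^sub>i\<close>. In \<open>distribute\<close>, every \<open>E\<^sub>i\<close> is paired with its set of clauses.
\<close>

definition distribute :: "('p expr \<times> 'p expr fset cset) fset \<Rightarrow> 'p expr fset cset" where
  "distribute G =
    acset {ffUnion (c |`| G) | c. \<forall>X \<in> fset G. c X \<in> rcset (snd X)}"

primrec clauses :: "'p expr \<Rightarrow> 'p expr fset cset" where
  "clauses Infty = csingle {|Infty|}"
| "clauses (Dev e w) = csingle {|Dev e w|}"
| "clauses (EMin C) = cUnion (cimage clauses C)"
| "clauses (EMax F) = distribute ((\<lambda>E. (E, clauses E)) |`| F)"

definition nf :: "'p expr \<Rightarrow> 'p expr" where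
  "nf E = EMin (cimage EMax (clauses E))"

text \<open>
  \<open>Abs_fset\<close> and \<open>acset\<close> are applied to sets that are finite, resp. countable, when the
  transition relations are finite.
\<close>

type_synonym ('s, 't, 'p) syn_distance = "'s \<Rightarrow> 't \<Rightarrow> 'p expr"

definition syn_op ::
  "('s::finite, 'ap) wks \<Rightarrow> ('t::finite, 'p::finite, 'ap) pwks \<Rightarrow>
    ('s, 't, 'p) syn_distance \<Rightarrow> ('s, 't, 'p) syn_distance" where
  "syn_op K KP d s t =
    (if label K s \<noteq> plabel KP t then nf Infty
     else nf (EMax ((\<lambda>(w, s').
            EMin (cimage (\<lambda>\<pi>.
              EMax {|Dev (acc_weight \<pi>) w,
                     d s' (last_state t \<pi>),
                     EMax (d s |`| fset_of_list (inner_states \<pi>))|})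
              (acset (seqs KP t))))
            |`| Abs_fset {(w, s'). (s, w, s') \<in> transitions K})))"

end

theory Submission
  imports Defs "HOL-Library.Cardinality"
begin

text \<open>
  Distributivity of \<open>MAX\<close> over \<open>MIN\<close> in the linear order \<open>[0, \<infinity>]\<close> makes normal forms
  value-preserving, so the syntactic iterates evaluate to the iterates of the semantic operator
  from the bottom element. By strong cost non-zenoness, a long transition sequence is already
  heavier than every weight of the Kripke structure before its last loop; cutting that loop
  improves all three components of the maximum. Hence sequences of length below a bound
  independent of the valuation suffice. For a fixed valuation all iterates then take values in a
  finite set whose cardinality does not depend on the valuation, so that the ascending chain of
  iterates becomes stationary after a number of steps that is uniform in the valuation.
\<close>

section \<open>Values of normal forms\<close>

definition clause_value :: "'p::finite expr fset \<Rightarrow> 'p valuation \<Rightarrow> ennreal" where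
  "clause_value F v = (SUP E \<in> fset F. expr_value E v)"

text \<open>In a linear order a nonempty finite supremum is attained; \<open>bot\<close> covers the
  empty set.\<close>

lemma Sup_mem_of_finite:
  fixes A :: "'a::complete_linorder set"
  assumes "finite A" "A \<subseteq> B" "bot \<in> B"
  shows "Sup A \<in> B"
  using assms by (induction A rule: finite_induct) (auto simp: sup_max max_def)

lemma Inf_mem_of_finite:
  fixes A :: "'a::complete_linorder set"
  assumes "finite A" "A \<subseteq> B" "top \<in> B"
  shows "Inf A \<in> B"
  using assms by (induction A rule: finite_induct) (auto simp: inf_min min_def)

text \<open>Were the left side below the right side \<open>r\<close>, every \<open>i\<close> would
  admit a choice with value below \<open>r\<close>. By linearity the finite supremum of these values
  stays strictly below \<open>r\<close>, although \<open>r\<close> is a lower bound of all such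
  suprema.\<close>

lemma SUP_INF_finite_choice:
  fixes f :: "'i \<Rightarrow> 'b \<Rightarrow> 'a::complete_linorder"
  assumes "finite I"
  shows "(SUP i\<in>I. INF x\<in>A i. f i x) = (INF c\<in>{c. \<forall>i\<in>I. c i \<in> A i}. SUP i\<in>I. f i (c i))"
    (is "?L = ?R")
proof (rule antisym)
  show "?L \<le> ?R"
    by (rule INF_greatest, rule SUP_mono) (auto intro: INF_lower)
  show "?R \<le> ?L"
  proof (rule leI, rule notI)
    define r where "r = ?R"
    assume "?L < ?R"
    then have less: "?L < r" by (simp only: r_def)
    have "\<exists>x. x \<in> A i \<and> f i x < r" if "i \<in> I" for i
    proof -
      have "(INF x\<in>A i. f i x) \<le> ?L"
        using that by (rule SUP_upper)
      then have "(INF x\<in>A i. f i x) < r"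
        using less by (rule order_le_less_trans)
      then show ?thesis by (auto simp: INF_less_iff)
    qed
    then have "\<forall>i\<in>I. \<exists>x. x \<in> A i \<and> f i x < r" by blast
    from bchoice[OF this] obtain c where c: "\<And>i. i \<in> I \<Longrightarrow> c i \<in> A i \<and> f i (c i) < r"
      by blast
    \<comment> \<open>For empty \<open>I\<close> the supremum is \<open>bot\<close>, which must also
      lie strictly below \<open>r\<close>.\<close>
    have "bot < r"
      using bot_least less by (rule order_le_less_trans)
    with assms c have "(SUP i\<in>I. f i (c i)) \<in> {..<r}"
      by (intro Sup_mem_of_finite) auto
    moreover have "r \<le> (SUP i\<in>I. f i (c i))"
      unfolding r_def using c by (intro INF_lower) simp
    ultimately show False by (simp add: leD)
  qed
qed

text \<open>\<open>acset\<close> is faithful on countable sets only. Each resulting clause is a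
  finite subset of the countable set \<open>V\<close>, and there are countably many of those. The
  clauses are counted rather than the functions \<open>c\<close>, which are arbitrary outside
  \<open>G\<close>.\<close>

lemma rcset_distribute:
  "rcset (distribute G) = {ffUnion (c |`| G) | c. \<forall>X \<in> fset G. c X \<in> rcset (snd X)}"
proof -
  let ?D = "{ffUnion (c |`| G) | c. \<forall>X \<in> fset G. c X \<in> rcset (snd X)}"
  define V where "V = (\<Union>X\<in>fset G. \<Union>F\<in>rcset (snd X). fset F)"
  have "countable V"
    unfolding V_def by (intro countable_UN) (auto intro: countable_finite)
  then have "countable {A. A \<subseteq> V \<and> finite A}"
    using countable_Collect_finite_subset by (simp add: conj_commute)
  moreover have "fset ` ?D \<subseteq> {A. A \<subseteq> V \<and> finite A}"
    by (force simp: V_def ffUnion.rep_eq)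
  ultimately have "countable (fset ` ?D)"
    by (rule countable_subset[rotated])
  then have "countable ?D"
    by (rule countable_image_inj_on) (simp add: inj_on_def fset_inject)
  then show ?thesis
    unfolding distribute_def by (simp add: acset_inverse)
qed

lemma clause_value_ffUnion:
  "clause_value (ffUnion (c |`| G)) v = (SUP X\<in>fset G. clause_value (c X) v)"
  unfolding clause_value_def by (simp add: ffUnion.rep_eq SUP_UNION)

text \<open>At \<open>EMax\<close>, finite distributivity turns the supremum of infima into one
  infimum over choices, and these are what \<open>distribute\<close> enumerates.\<close>

lemma expr_value_clauses:
  "expr_value E v = (INF F\<in>rcset (clauses E). clause_value F v)"
proof (induction E)
  case (EMin C)
  have "expr_value (EMin C) v = (INF E\<in>rcset C. expr_value E v)"
    by (simp add: cimage.rep_eq)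
  also have "\<dots> = (INF E\<in>rcset C. INF F\<in>rcset (clauses E). clause_value F v)"
    using EMin by (intro INF_cong) auto
  also have "\<dots> = (INF F\<in>rcset (clauses (EMin C)). clause_value F v)"
    by (rule antisym)
      (auto simp: cUnion.rep_eq cimage.rep_eq intro!: INF_greatest intro: INF_lower INF_lower2)
  finally show ?case .
next
  case (EMax F)
  define G where "G = (\<lambda>E. (E, clauses E)) |`| F"
  have "expr_value (EMax F) v = (SUP E\<in>fset F. expr_value E v)"
    by simp
  also have "\<dots> = (SUP E\<in>fset F. INF H\<in>rcset (clauses E). clause_value H v)"
    using EMax by (intro SUP_cong) auto
  also have "\<dots> = (SUP X\<in>fset G. INF H\<in>rcset (snd X). clause_value H v)"
    by (simp add: G_def image_image)
  also have "\<dots> = (INF c\<in>{c. \<forall>X\<in>fset G. c X \<in> rcset (snd X)}.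
      SUP X\<in>fset G. clause_value (c X) v)"
    by (rule SUP_INF_finite_choice) simp
  also have "\<dots> = (INF H\<in>rcset (distribute G). clause_value H v)"
    by (simp only: rcset_distribute clause_value_ffUnion[symmetric] setcompr_eq_image image_image)
  also have "\<dots> = (INF H\<in>rcset (clauses (EMax F)). clause_value H v)"
    by (simp add: G_def)
  finally show ?case .
qed (simp_all add: clause_value_def cinsert.rep_eq bot_cset.rep_eq)

lemma expr_value_nf: "expr_value (nf E) v = expr_value E v"
  unfolding expr_value_clauses[of E] nf_def by (simp add: cimage.rep_eq image_image clause_value_def)

section \<open>Transition sequences\<close>

lemma is_seq_steps: "is_seq KP t \<pi> \<Longrightarrow> set \<pi> \<subseteq> snd ` ptransitions KP"
  by (induction KP t \<pi> rule: is_seq.induct) force+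

lemma countable_seqs:
  assumes "finite (ptransitions KP)"
  shows "countable (seqs KP t)"
proof -
  have "seqs KP t \<subseteq> lists (snd ` ptransitions KP)"
    using is_seq_steps[of KP t] by (auto simp: seqs_def)
  with assms show ?thesis
    by (meson countable_finite countable_lists countable_subset finite_imageI)
qed

lemma finite_successors:
  assumes "is_wks K"
  shows "finite {(w, s'). (s, w, s') \<in> transitions K}"
proof (rule finite_subset)
  show "{(w, s'). (s, w, s') \<in> transitions K} \<subseteq> snd ` transitions K"
    by force
qed (use assms in \<open>simp add: is_wks_def\<close>)

text \<open>Evaluation intertwines the two operators: normal forms keep values, and finite
  transition relations make \<open>Abs_fset\<close> and \<open>acset\<close> faithful.\<close>

lemma expr_value_syn_op:
  fixes K :: "('s::finite, 'ap) wks" and KP :: "('t::finite, 'p::finite, 'ap) pwks"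
  assumes "is_wks K" "is_pwks KP"
  shows "expr_value (syn_op K KP d s t) v = sem_op K KP (\<lambda>s t. expr_value (d s t)) s t v"
proof -
  define T where "T = {(w, s'). (s, w, s') \<in> transitions K}"
  have "finite T"
    unfolding T_def using assms(1) by (rule finite_successors)
  then have "fset (Abs_fset T) = T"
    by (simp add: Abs_fset_inverse)
  moreover have "rcset (acset (seqs KP t)) = seqs KP t"
    using countable_seqs[of KP t] assms(2) by (simp add: is_pwks_def acset_inverse)
  ultimately show ?thesis
    unfolding syn_op_def sem_op_def T_def[symmetric]
    by (simp add: expr_value_nf cimage.rep_eq image_image case_prod_unfold fset_of_list.rep_eq)
qed

section \<open>Loops in long sequences and their removal\<close>

lemma is_seq_append:
  "is_seq KP t (\<alpha> @ \<beta>) \<longleftrightarrow> is_seq KP t \<alpha> \<and> is_seq KP (last_state t \<alpha>) \<beta>"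
  by (induction KP t \<alpha> rule: is_seq.induct) (auto simp: last_state_def)

lemma last_state_append: "last_state t (\<alpha> @ \<beta>) = last_state (last_state t \<alpha>) \<beta>"
  by (simp add: last_state_def last_append)

lemma lin_value_lin_add: "lin_value (lin_add e e') v = lin_value e v + lin_value e' v"
  by (cases e; cases e')
    (simp add: real_of_nnrat_def plus_nnrat.rep_eq of_rat_add algebra_simps sum.distrib)

lemma lin_value_nonneg: "lin_value e v \<ge> 0"
  using rat_of_nnrat
  by (cases e) (auto simp: real_of_nnrat_def intro!: sum_nonneg add_nonneg_nonneg mult_nonneg_nonneg)

lemma lin_value_lin_zero: "lin_value lin_zero v = 0"
  by (simp add: lin_zero_def real_of_nnrat_def zero_nnrat.rep_eq)

lemma lin_value_acc_weight_append:
  "lin_value (acc_weight (\<alpha> @ \<beta>)) v = lin_value (acc_weight \<alpha>) v + lin_value (acc_weight \<beta>) v"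
  by (induction \<alpha>) (auto simp: acc_weight_def lin_value_lin_add lin_value_lin_zero)

lemma set_inner_states_cut: "set (inner_states (\<alpha> @ \<gamma>)) \<subseteq> set (inner_states (\<alpha> @ \<beta> @ \<gamma>))"
  by (auto simp: inner_states_def butlast_append dest: in_set_butlastD)

text \<open>Pigeonhole: \<open>n\<close> steps visit \<open>n + 1\<close> states, so
  \<open>CARD('t)\<close> steps already force a repetition, and the segment between the two visits
  is a loop.\<close>

lemma exists_loop:
  fixes KP :: "('t::finite, 'p, 'ap) pwks"
  assumes "is_seq KP t \<pi>" "length \<pi> \<ge> CARD('t)"
  obtains \<alpha> \<beta> \<gamma> where "\<pi> = \<alpha> @ \<beta> @ \<gamma>" "is_loop KP (last_state t \<alpha>) \<beta>"
proof -
  have "\<not> distinct (t # map snd \<pi>)"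
  proof
    assume "distinct (t # map snd \<pi>)"
    then have "card (set (t # map snd \<pi>)) = Suc (length \<pi>)"
      by (metis distinct_card length_Cons length_map)
    moreover have "card (set (t # map snd \<pi>)) \<le> CARD('t)"
      by (intro card_mono) auto
    ultimately show False using assms(2) by linarith
  qed
  then obtain i j where ij: "i < j" "j < Suc (length \<pi>)"
      "(t # map snd \<pi>) ! i = (t # map snd \<pi>) ! j"
    by (metis distinct_conv_nth length_Cons length_map linorder_neqE_nat)
  \<comment> \<open>Position 0 holds the start state, so prefix lengths and positions agree without
    a shift.\<close>
  have last_take: "last_state t (take k \<pi>) = (t # map snd \<pi>) ! k" if "k < Suc (length \<pi>)" for k
    using that by (cases k) (auto simp: last_state_def last_conv_nth)
  define \<beta> where "\<beta> = drop i (take j \<pi>)"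
  have takes: "take j \<pi> = take i \<pi> @ \<beta>"
    using ij(1) unfolding \<beta>_def
    by (metis append_take_drop_id less_imp_le min.absorb1 take_take)
  have dec: "\<pi> = take i \<pi> @ \<beta> @ drop j \<pi>"
    using takes by (metis append.assoc append_take_drop_id)
  have "\<beta> \<noteq> []"
    using ij by (simp add: \<beta>_def)
  moreover have "is_seq KP (last_state t (take i \<pi>)) \<beta>"
    using assms(1) dec by (metis is_seq_append)
  moreover have "last_state (last_state t (take i \<pi>)) \<beta> = last_state t (take i \<pi>)"
    unfolding last_state_append[symmetric] takes[symmetric] using ij by (simp add: last_take)
  ultimately show thesis
    using that dec unfolding is_loop_def by blast
qed

text \<open>Each of \<open>k\<close> consecutive blocks of \<open>CARD('t)\<close> steps contains a
  loop costing at least \<open>wmin\<close>; all other weights are nonnegative.\<close>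

lemma weight_ge_of_length:
  fixes KP :: "('t::finite, 'p::finite, 'ap) pwks"
  assumes loops: "\<And>t \<pi>. is_loop KP t \<pi> \<Longrightarrow> wmin \<le> lin_value (acc_weight \<pi>) v"
    and "is_seq KP t \<pi>" "k * CARD('t) \<le> length \<pi>"
  shows "real k * wmin \<le> lin_value (acc_weight \<pi>) v"
  using assms(2,3)
proof (induction k arbitrary: t \<pi>)
  case 0
  then show ?case by (simp add: lin_value_nonneg)
next
  case (Suc k)
  define \<rho> \<sigma> where "\<rho> = take CARD('t) \<pi>" and "\<sigma> = drop CARD('t) \<pi>"
  have dec: "\<pi> = \<rho> @ \<sigma>" by (simp add: \<rho>_def \<sigma>_def)
  have \<rho>: "is_seq KP t \<rho>" and \<sigma>: "is_seq KP (last_state t \<rho>) \<sigma>"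
    using Suc.prems(1) unfolding dec is_seq_append by auto
  have "CARD('t) \<le> length \<rho>"
    using Suc.prems(2) by (simp add: \<rho>_def)
  with \<rho> obtain \<alpha> \<beta> \<gamma> where "\<rho> = \<alpha> @ \<beta> @ \<gamma>" "is_loop KP (last_state t \<alpha>) \<beta>"
    by (rule exists_loop)
  then have "wmin \<le> lin_value (acc_weight \<rho>) v"
    using loops[of "last_state t \<alpha>" \<beta>] lin_value_nonneg[of "acc_weight \<alpha>" v]
      lin_value_nonneg[of "acc_weight \<gamma>" v]
    by (simp add: lin_value_acc_weight_append)
  moreover have "real k * wmin \<le> lin_value (acc_weight \<sigma>) v"
    using Suc.prems(2) by (intro Suc.IH[OF \<sigma>]) (simp add: \<sigma>_def)
  ultimately show ?case
    by (simp add: dec lin_value_acc_weight_append algebra_simps)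
qed

text \<open>For \<open>x\<close> at least \<open>w > 0\<close> the deviation is
  \<open>x / w - 1\<close>, which increases with \<open>x\<close>; for \<open>w = 0\<close> both
  sides are infinite.\<close>

lemma deviation_mono:
  assumes "real_of_nnrat w \<le> x" "x \<le> y" "0 < x"
  shows "deviation x w \<le> deviation y w"
proof (cases "w = 0")
  case False
  have "rat_of_nnrat w \<noteq> 0"
    using False by (metis rat_of_nnrat_inject zero_nnrat.rep_eq)
  then have "0 < real_of_nnrat w"
    using rat_of_nnrat[of w] by (simp add: real_of_nnrat_def)
  with assms have "1 \<le> x / real_of_nnrat w" "x / real_of_nnrat w \<le> y / real_of_nnrat w"
    by (auto simp: divide_right_mono)
  then show ?thesis
    using False by (simp add: deviation_def ennreal_leI)
qed (use assms in \<open>auto simp: deviation_def\<close>)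

definition seq_value ::
  "('s, 't, 'p::finite) distance \<Rightarrow> 's \<Rightarrow> 't \<Rightarrow> nnrat \<Rightarrow> 's \<Rightarrow> 'p valuation \<Rightarrow> ('t, 'p) steps \<Rightarrow> ennreal"
  where
  "seq_value d s t w s' v \<pi> =
    Sup {deviation (lin_value (acc_weight \<pi>) v) w, d s' (last_state t \<pi>) v,
      (SUP u \<in> set (inner_states \<pi>). d s u v)}"

text \<open>Loops are cut out one at a time. A cut keeps the final state, adds no inner state, and
  lowers the weight without passing below \<open>w\<close>, so the deviation does not grow. The
  length bound does not mention \<open>v\<close>.\<close>

lemma exists_short_seq:
  fixes KP :: "('t::finite, 'p::finite, 'ap) pwks"
  assumes loops: "\<And>t \<pi>. is_loop KP t \<pi> \<Longrightarrow> wmin \<le> lin_value (acc_weight \<pi>) v"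
    and k: "0 < real k * wmin" "real_of_nnrat w \<le> real k * wmin"
    and "is_seq KP t \<pi>"
  shows "\<exists>\<pi>'. is_seq KP t \<pi>' \<and> length \<pi>' < Suc k * CARD('t) \<and>
    seq_value d s t w s' v \<pi>' \<le> seq_value d s t w s' v \<pi>"
  using assms(4)
proof (induction "length \<pi>" arbitrary: \<pi> rule: less_induct)
  case less
  show ?case
  proof (cases "length \<pi> < Suc k * CARD('t)")
    case True
    with less.prems show ?thesis by blast
  next
    case False
    \<comment> \<open>The prefix \<open>\<alpha>\<close> alone weighs at least
      \<open>real k * wmin\<close> and survives the cut; the further \<open>CARD('t)\<close> steps
      in \<open>\<rho>\<close> supply the loop to remove.\<close>
    define \<alpha> \<rho> where "\<alpha> = take (k * CARD('t)) \<pi>" and "\<rho> = drop (k * CARD('t)) \<pi>"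
    have \<pi>: "\<pi> = \<alpha> @ \<rho>" by (simp add: \<alpha>_def \<rho>_def)
    have \<alpha>: "is_seq KP t \<alpha>" and \<rho>: "is_seq KP (last_state t \<alpha>) \<rho>"
      using less.prems unfolding \<pi> is_seq_append by auto
    have "CARD('t) \<le> length \<rho>"
      using False by (simp add: \<rho>_def)
    with \<rho> obtain \<beta> \<gamma> \<delta> where dec: "\<rho> = \<beta> @ \<gamma> @ \<delta>"
      and loop: "is_loop KP (last_state (last_state t \<alpha>) \<beta>) \<gamma>"
      by (rule exists_loop)
    define \<pi>' where "\<pi>' = (\<alpha> @ \<beta>) @ \<delta>"
    have \<pi>_dec: "\<pi> = (\<alpha> @ \<beta>) @ \<gamma> @ \<delta>" by (simp add: \<pi> dec)
    have seq: "is_seq KP t \<pi>'" and last: "last_state t \<pi>' = last_state t \<pi>"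
      using less.prems loop unfolding \<pi>_dec \<pi>'_def is_loop_def
      by (auto simp: is_seq_append last_state_append)
    have inner: "set (inner_states \<pi>') \<subseteq> set (inner_states \<pi>)"
      unfolding \<pi>_dec \<pi>'_def by (rule set_inner_states_cut)
    have "real k * wmin \<le> lin_value (acc_weight \<alpha>) v"
      using loops False by (intro weight_ge_of_length[OF _ \<alpha>]) (auto simp: \<alpha>_def)
    then have ge: "real k * wmin \<le> lin_value (acc_weight \<pi>') v"
      using lin_value_nonneg[of "acc_weight \<beta>" v] lin_value_nonneg[of "acc_weight \<delta>" v]
      by (simp add: \<pi>'_def lin_value_acc_weight_append)
    have "lin_value (acc_weight \<pi>') v \<le> lin_value (acc_weight \<pi>) v"
      using lin_value_nonneg[of "acc_weight \<gamma>" v]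
      by (simp add: \<pi>'_def \<pi>_dec lin_value_acc_weight_append)
    with ge k have "deviation (lin_value (acc_weight \<pi>') v) w
        \<le> deviation (lin_value (acc_weight \<pi>) v) w"
      by (intro deviation_mono) linarith+
    moreover have "(SUP u \<in> set (inner_states \<pi>'). d s u v) \<le> (SUP u \<in> set (inner_states \<pi>). d s u v)"
      using inner by (rule SUP_subset_mono) simp
    ultimately have le: "seq_value d s t w s' v \<pi>' \<le> seq_value d s t w s' v \<pi>"
      unfolding seq_value_def last by (simp add: sup.coboundedI1 sup.coboundedI2)
    have "length \<pi>' < length \<pi>"
      using loop by (simp add: \<pi>'_def \<pi>_dec is_loop_def)
    from less.hyps[OF this seq] le show ?thesis
      using order_trans by blast
  qed
qed

section \<open>Uniform stabilisation\<close>

text \<open>The chain is turned into one of subsets of \<open>UNIV \<times> B\<close>. By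
  \<open>stable\<close> it grows strictly until it halts for good, so it can grow at most
  \<open>CARD('i) * card B\<close> times.\<close>

lemma ascending_chain_stable:
  fixes a :: "nat \<Rightarrow> 'i::finite \<Rightarrow> 'a::linorder"
  assumes mono: "\<And>n i. a n i \<le> a (Suc n) i"
    and stable: "\<And>n. a n = a (Suc n) \<Longrightarrow> a (Suc n) = a (Suc (Suc n))"
    and range: "\<And>n i. a n i \<in> B" and B: "finite B" "card B \<le> M"
  shows "a (CARD('i) * M) = a (Suc (CARD('i) * M))"
proof -
  \<comment> \<open>The down-sets determine \<open>a n\<close> because its values lie in \<open>B\<close>.\<close>
  define D where "D n = {(i, b). b \<in> B \<and> b \<le> a n i}" for n
  let ?S = "(UNIV :: 'i set) \<times> B"
  have sub: "D n \<subseteq> ?S" for n by (auto simp: D_def)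
  have finS: "finite ?S" using B by simp
  have inj: "a m i \<le> a n i" if "D m \<subseteq> D n" for m n i
    using that range[of m i] by (auto simp: D_def)
  have D_eq: "D m = D n \<longleftrightarrow> a m = a n" for m n
  proof
    assume "D m = D n"
    then show "a m = a n" by (intro ext antisym inj) auto
  qed (simp add: D_def)
  have "mono D"
    unfolding mono_iff_le_Suc by (auto simp: D_def intro: order_trans[OF _ mono])
  moreover have "finite (range D)"
    using sub finS by (intro finite_subset[of "range D" "Pow ?S"]) auto
  moreover have "\<forall>n. D n = D (Suc n) \<longrightarrow> D (Suc n) = D (Suc (Suc n))"
    using stable by (simp add: D_eq)
  ultimately have "\<exists>N. (\<forall>n\<le>N. \<forall>m\<le>N. m < n \<longrightarrow> D m \<subset> D n) \<and> (\<forall>n\<ge>N. D N = D n)"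
    by (intro finite_mono_remains_stable_implies_strict_prefix)
  from finite_mono_strict_prefix_implies_finite_fixpoint[OF sub finS this]
  have fixpoint: "D (card ?S) = (\<Union>n. D n)" .
  \<comment> \<open>Passing to \<open>M\<close> frees the index from \<open>B\<close>, which will
    vary with the valuation.\<close>
  have "card ?S \<le> CARD('i) * M"
    using B by (simp add: card_cartesian_product)
  then have "D n = D (card ?S)" if "CARD('i) * M \<le> n" for n
    using fixpoint that monoD[OF \<open>mono D\<close>, of "card ?S" n] by (intro antisym) auto
  then show ?thesis
    by (metis D_eq le_refl le_SucI)
qed

section \<open>Finitely many values at each valuation, and a common stopping index\<close>

lemma sem_op_cong_valuation:
  "(\<And>s t. d s t v = d' s t v) \<Longrightarrow> sem_op K KP d s t v = sem_op K KP d' s t v"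
  by (simp add: sem_op_def)

text \<open>\<open>P\<close> collects the short sequences paired with the weights of
  \<open>K\<close> and is chosen before \<open>v\<close>, which makes the later count uniform.
  Finite suprema and infima in a linear order merely select among old values, deviations from
  \<open>P\<close>, 0 and infinity.\<close>

lemma sem_op_mem_finite_values:
  fixes K :: "('s::finite, 'ap) wks" and KP :: "('t::finite, 'p::finite, 'ap) pwks"
  assumes "is_wks K" "is_pwks KP" "strongly_cost_non_zeno KP"
  obtains P :: "(('t, 'p) steps \<times> nnrat) set"
  where "finite P"
    and "\<And>d s t v B. \<lbrakk>\<And>s t. d s t v \<in> B; 0 \<in> B; \<infinity> \<in> B;
      (\<lambda>(\<pi>, w). deviation (lin_value (acc_weight \<pi>) v) w) ` P \<subseteq> B\<rbrakk> \<Longrightarrow> sem_op K KP d s t v \<in> B"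
proof -
  from assms(3) obtain wmin where wmin: "wmin > 0"
    and loops: "\<And>v t \<pi>. is_loop KP t \<pi> \<Longrightarrow> wmin \<le> lin_value (acc_weight \<pi>) v"
    unfolding strongly_cost_non_zeno_def by blast
  define W where "W = (\<lambda>(s, w, s'). w) ` transitions K"
  have finW: "finite W" using assms(1) by (simp add: W_def is_wks_def)
  \<comment> \<open>The inserted 1 makes \<open>m\<close> positive even if all weights are 0 or
    there are no transitions.\<close>
  define m where "m = Max (insert 1 (real_of_nnrat ` W))"
  have m: "1 \<le> m" "\<And>w. w \<in> W \<Longrightarrow> real_of_nnrat w \<le> m"
    using finW by (auto simp: m_def)
  \<comment> \<open>So many loops outweigh every weight of \<open>K\<close>, under every
    valuation.\<close>
  obtain k :: nat where k: "m < real k * wmin"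
    using reals_Archimedean3[OF wmin] by blast
  define R where "R t = {\<pi>. is_seq KP t \<pi> \<and> length \<pi> < Suc k * CARD('t)}" for t
  have finR: "finite (R t)" for t
  proof (rule finite_subset)
    show "R t \<subseteq> {\<pi>. set \<pi> \<subseteq> snd ` ptransitions KP \<and> length \<pi> \<le> Suc k * CARD('t)}"
      using is_seq_steps[of KP t] by (auto simp: R_def)
    show "finite {\<pi>. set \<pi> \<subseteq> snd ` ptransitions KP \<and> length \<pi> \<le> Suc k * CARD('t)}"
      using assms(2) by (intro finite_lists_length_le) (simp add: is_pwks_def)
  qed
  define P where "P = (\<Union>t. R t) \<times> W"
  show thesis
  proof (rule that)
    show "finite P" using finR finW by (simp add: P_def)
  next
    fix d :: "('s, 't, 'p) distance" and s t v B
    assume d: "\<And>s t. d s t v \<in> B" and 0: "0 \<in> B" and inf: "\<infinity> \<in> B"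
      and dev: "(\<lambda>(\<pi>, w). deviation (lin_value (acc_weight \<pi>) v) w) ` P \<subseteq> B"
    \<comment> \<open>These are the values of the empty supremum and the empty infimum, as the two
      selection lemmas require.\<close>
    have bot: "bot \<in> B" and top: "top \<in> B" using 0 inf by (auto simp: bot_ennreal)
    have inner: "(INF \<pi>\<in>seqs KP t. seq_value d s t w s' v \<pi>) \<in> B"
      if "(s, w, s') \<in> transitions K" for w s'
    proof -
      have w: "w \<in> W" using that by (force simp: W_def)
      have "(INF \<pi>\<in>seqs KP t. seq_value d s t w s' v \<pi>) = (INF \<pi>\<in>R t. seq_value d s t w s' v \<pi>)"
      proof (rule antisym)
        show "(INF \<pi>\<in>R t. seq_value d s t w s' v \<pi>) \<le> (INF \<pi>\<in>seqs KP t. seq_value d s t w s' v \<pi>)"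
        proof (rule INF_mono)
          fix \<pi> assume "\<pi> \<in> seqs KP t"
          moreover have "0 < real k * wmin" "real_of_nnrat w \<le> real k * wmin"
            using k m(1) m(2)[OF w] by linarith+
          ultimately show "\<exists>\<pi>'\<in>R t. seq_value d s t w s' v \<pi>' \<le> seq_value d s t w s' v \<pi>"
            using exists_short_seq[of KP wmin v k w t \<pi> d s s'] loops
            by (auto simp: R_def seqs_def)
        qed
      qed (auto simp: R_def seqs_def intro: INF_superset_mono)
      also have "\<dots> \<in> B"
      proof (intro Inf_mem_of_finite top finite_imageI finR image_subsetI)
        fix \<pi> assume \<pi>: "\<pi> \<in> R t"
        have "deviation (lin_value (acc_weight \<pi>) v) w \<in> B"
          using dev \<pi> w by (auto simp: P_def)
        moreover have "(SUP u \<in> set (inner_states \<pi>). d s u v) \<in> B"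
          using d bot by (intro Sup_mem_of_finite) auto
        ultimately show "seq_value d s t w s' v \<pi> \<in> B"
          unfolding seq_value_def using d bot by (intro Sup_mem_of_finite) auto
      qed
      finally show ?thesis .
    qed
    have "(SUP (w, s') \<in> {(w, s'). (s, w, s') \<in> transitions K}.
        INF \<pi>\<in>seqs KP t. seq_value d s t w s' v \<pi>) \<in> B"
      using inner bot finite_successors[OF assms(1)] by (intro Sup_mem_of_finite) auto
    then show "sem_op K KP d s t v \<in> B"
      using inf by (auto simp: sem_op_def seq_value_def)
  qed
qed

lemma sem_op_iterates_stable:
  fixes K :: "('s::finite, 'ap) wks" and KP :: "('t::finite, 'p::finite, 'ap) pwks"
  assumes "is_wks K" "is_pwks KP" "strongly_cost_non_zeno KP"
  shows "\<exists>n. (sem_op K KP ^^ Suc n) bot = (sem_op K KP ^^ n) bot"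
proof -
  obtain P :: "(('t, 'p) steps \<times> nnrat) set" where finP: "finite P"
    and closed: "\<And>d s t v B. \<lbrakk>\<And>s t. d s t v \<in> B; 0 \<in> B; \<infinity> \<in> B;
      (\<lambda>(\<pi>, w). deviation (lin_value (acc_weight \<pi>) v) w) ` P \<subseteq> B\<rbrakk> \<Longrightarrow> sem_op K KP d s t v \<in> B"
    using sem_op_mem_finite_values[OF assms] by blast
  let ?F = "sem_op K KP"
  \<comment> \<open>At any one valuation \<open>P\<close> yields at most \<open>card P\<close>
    deviations, and 0 and infinity add two values; the pairs of states index the chain.\<close>
  define N where "N = CARD('s \<times> 't) * (card P + 2)"
  have "(?F ^^ N) bot s t v = (?F ^^ Suc N) bot s t v" for s t v
  proof -
    \<comment> \<open>The slice of the iterates at the fixed \<open>v\<close>: its values are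
      linearly ordered, and its index set is finite, unlike the set of valuations.\<close>
    define a where "a n = (\<lambda>(s, t). (?F ^^ n) bot s t v)" for n
    define V where "V = (\<lambda>(\<pi>, w). deviation (lin_value (acc_weight \<pi>) v) w) ` P"
    define B where "B = insert 0 (insert \<infinity> V)"
    have "a (CARD('s \<times> 't) * (card P + 2)) = a (Suc (CARD('s \<times> 't) * (card P + 2)))"
    proof (rule ascending_chain_stable)
      fix n i
      have "(?F ^^ n) bot \<le> (?F ^^ Suc n) bot"
        by (rule funpow_decreasing[OF _ mono_sem_op]) simp
      then show "a n i \<le> a (Suc n) i"
        by (simp only: a_def le_fun_def split: prod.split) simp
    next
      fix n assume "a n = a (Suc n)"
      then have "(?F ^^ n) bot s t v = (?F ^^ Suc n) bot s t v" for s t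
        by (metis (mono_tags, lifting) a_def case_prod_conv)
      \<comment> \<open>The operator acts on each valuation separately, so equality at
        \<open>v\<close> alone propagates.\<close>
      then have "?F ((?F ^^ n) bot) s t v = ?F ((?F ^^ Suc n) bot) s t v" for s t
        by (rule sem_op_cong_valuation)
      then have "(\<lambda>s t. (?F ^^ Suc n) bot s t v) = (\<lambda>s t. (?F ^^ Suc (Suc n)) bot s t v)"
        unfolding funpow.simps comp_apply by (intro ext)
      then show "a (Suc n) = a (Suc (Suc n))"
        unfolding a_def by (rule arg_cong)
    next
      have "(?F ^^ n) bot s t v \<in> B" for n s t
      proof (induction n arbitrary: s t)
        case 0
        then show ?case by (simp add: B_def bot_ennreal)
      next
        case (Suc n)
        have "?F ((?F ^^ n) bot) s t v \<in> B"
        proof (rule closed)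
          show "(?F ^^ n) bot s t v \<in> B" for s t by (rule Suc.IH)
        qed (auto simp: B_def V_def)
        then show ?case by (simp only: funpow.simps comp_apply)
      qed
      then show "a n i \<in> B" for n i
        by (simp add: a_def split: prod.split)
    next
      show "finite B" using finP by (simp add: B_def V_def)
      have "card B \<le> Suc (Suc (card V))"
        using finP by (simp add: B_def V_def card_insert_if)
      also have "card V \<le> card P"
        unfolding V_def by (rule card_image_le[OF finP])
      finally show "card B \<le> card P + 2" by simp
    qed
    then have "a N (s, t) = a (Suc N) (s, t)" by (simp only: N_def)
    then show ?thesis by (simp only: a_def prod.case)
  qed
  then have "(?F ^^ N) bot = (?F ^^ Suc N) bot" by blast
  then show ?thesis by metis
qed

theorem theorem4:
  fixes K :: "('s::finite, 'ap) wks"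
    and KP :: "('t::finite, 'p::finite, 'ap) pwks"
    and d0 :: "('s, 't, 'p) syn_distance"
  assumes "is_wks K"
    and "is_pwks KP"
    and "strongly_cost_non_zeno KP"
    and "\<And>s t. normal_form (d0 s t)"
    and "\<And>s t v. expr_value (d0 s t) v = 0"
  shows "\<exists>n::nat. \<forall>s t v. expr_value ((syn_op K KP ^^ n) d0 s t) v = d_min K KP s t v"
proof -
  \<comment> \<open>The initial value 0 is \<open>bot\<close>, so the evaluated iterates are the
    Kleene iterates.\<close>
  have iterates: "(\<lambda>s t. expr_value ((syn_op K KP ^^ n) d0 s t)) = (sem_op K KP ^^ n) bot" for n
  proof (induction n)
    case 0
    then show ?case using assms(5) by (simp add: fun_eq_iff bot_ennreal)
  next
    case (Suc n)
    show ?case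
      by (simp only: funpow.simps comp_apply expr_value_syn_op[OF assms(1,2)] flip: Suc.IH)
  qed
  obtain n where "(sem_op K KP ^^ Suc n) bot = (sem_op K KP ^^ n) bot"
    using sem_op_iterates_stable[OF assms(1-3)] by blast
  \<comment> \<open>A repeated iterate is a fixed point, and by monotonicity iterates from
    \<open>bot\<close> lie below every fixed point.\<close>
  then have "d_min K KP = (sem_op K KP ^^ n) bot"
    unfolding d_min_def by (rule lfp_Kleene_iter[OF mono_sem_op])
  then show ?thesis
    using iterates[of n] by (auto simp: fun_eq_iff intro!: exI[of _ n])
qed

end
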